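(* If a Banach space $X$ contains $\ell_1^n$ isometrically for each $n\in\mathbb{N}$, but does not contain $\ell_1$ isometrically, then there exists a locally finite metric space $M$ such that $X$ contains isometrically each finite subset of $M$, but does not contain an isometric copy of $M$.
   Context: Banach spaces are over $\mathbb{R}$. A metric space is locally finite if all of its balls of finite radius have finite cardinality. "$X$ contains $\ell_1^n$ (respectively $\ell_1$) isometrically" means that $X$ has a linear subspace linearly isometric to $\ell_1^n$ (respectively $\ell_1$). "$X$ contains a metric space isometrically" (or "contains an isometric copy of it") means that there is a distance-preserving, not necessarily linear, map from that metric space into $X$. *)

theory Defs
  imports "HOL-Analysis.Analysis"
begin

text \<open>
  The real space l1(I) for I a set of natural numbers. Its vectors are encoded as functions
  on all of \<^typ>\<open>nat\<close> that vanish outside I, so that l1({..<n}) is the n-dimensional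
  space and l1(UNIV) is the space of absolutely summable sequences.
\<close>

definition l1_space :: "nat set \<Rightarrow> (nat \<Rightarrow> real) set" where
  "l1_space I = {x. (\<forall>i. i \<notin> I \<longrightarrow> x i = 0) \<and> (\<lambda>i. \<bar>x i\<bar>) summable_on I}"

definition l1_norm :: "nat set \<Rightarrow> (nat \<Rightarrow> real) \<Rightarrow> real" where
  "l1_norm I x = (\<Sum>\<^sub>\<infinity>i\<in>I. \<bar>x i\<bar>)"

text \<open>
  Linearity is spelled out pointwise, because functions \<^typ>\<open>nat \<Rightarrow> real\<close> are not an
  instance of class \<^class>\<open>real_vector\<close>.
\<close>

definition l1_linear_isometry :: "nat set \<Rightarrow> ((nat \<Rightarrow> real) \<Rightarrow> 'a::real_normed_vector) \<Rightarrow> bool" where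
  "l1_linear_isometry I T \<longleftrightarrow>
     (\<forall>x\<in>l1_space I. \<forall>y\<in>l1_space I. T (\<lambda>i. x i + y i) = T x + T y) \<and>
     (\<forall>c. \<forall>x\<in>l1_space I. T (\<lambda>i. c * x i) = c *\<^sub>R T x) \<and>
     (\<forall>x\<in>l1_space I. norm (T x) = l1_norm I x)"

definition contains_l1_isometrically :: "'a::real_normed_vector set \<Rightarrow> nat set \<Rightarrow> bool" where
  "contains_l1_isometrically X I \<longleftrightarrow>
     (\<exists>S T. subspace S \<and> S \<subseteq> X \<and> l1_linear_isometry I T \<and> T ` l1_space I = S)"

definition contains_metric_isometrically ::
    "'a::metric_space set \<Rightarrow> 'b set \<Rightarrow> ('b \<Rightarrow> 'b \<Rightarrow> real) \<Rightarrow> bool" where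
  "contains_metric_isometrically X M d \<longleftrightarrow>
     (\<exists>f. f \<in> M \<rightarrow> X \<and> (\<forall>x\<in>M. \<forall>y\<in>M. dist (f x) (f y) = d x y))"

definition locally_finite_metric_space :: "'b set \<Rightarrow> ('b \<Rightarrow> 'b \<Rightarrow> real) \<Rightarrow> bool" where
  "locally_finite_metric_space M d \<longleftrightarrow>
     Metric_space M d \<and> (\<forall>x\<in>M. \<forall>r. finite (Metric_space.mcball M d x r))"

text \<open>
  Locally finite metric spaces are countable; up to isometry they can therefore all be taken to
  have a set of natural numbers as underlying set.
\<close>

lemma locally_finite_metric_space_countable:
  assumes "locally_finite_metric_space M d"
  shows "countable M"
proof (cases "M = {}")
  case False
  then obtain x where x: "x \<in> M" by blast
  interpret Metric_space M d
    using assms by (simp add: locally_finite_metric_space_def)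
  have "countable (\<Union>n::nat. mcball x (real n))"
    using assms x by (auto simp: locally_finite_metric_space_def countable_finite)
  moreover have "M \<subseteq> (\<Union>n::nat. mcball x (real n))"
    using x by (auto simp: real_arch_simple)
  ultimately show ?thesis
    by (rule countable_subset[rotated])
qed simp

end

theory Submission
  imports Defs
begin

unbundle bit_operations_syntax

text \<open>
  Take the finite subsets of \<^typ>\<open>nat\<close>, coded as natural numbers by binary expansion, with the
  distance \<open>\<Sum>i\<in>A \<triangle> B. 2^i\<close>, that is \<open>m XOR n\<close>. Its finite subsets lie in cubes of some \<open>l1\<^sup>n\<close>.
  If \<open>f\<close> embeds the whole space isometrically into \<open>X\<close>, the vectors \<open>u\<^sub>i = (f {i} - f \<emptyset>) / 2^i\<close>
  span a linear copy of l1: for a choice of signs on \<open>{..<n}\<close>, let \<open>P\<close> and \<open>N\<close> be the sets of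
  positive and of negative indices. Then for every \<open>i < n\<close> the pair \<open>\<emptyset>, {i}\<close> lies on a geodesic
  from \<open>N\<close> to \<open>P\<close>, traversed in the direction of the sign of \<open>i\<close>, and so a single functional
  norming \<open>f P - f N\<close> norms all signed \<open>u\<^sub>i\<close> with \<open>i < n\<close> simultaneously.
\<close>

section \<open>XOR as a locally finite metric on the natural numbers\<close>

text \<open>XOR is addition without carries; the induction strips the lowest binary digit of both
  numbers.\<close>

lemma xor_nat_le_add: "m XOR n \<le> m + n" for m n :: nat
proof (induction m arbitrary: n rule: less_induct)
  case (less m)
  show ?case
  proof (cases "m = 0")
    case False
    then have "m div 2 XOR n div 2 \<le> m div 2 + n div 2"
      by (intro less.IH) simp
    moreover have "m XOR n = of_bool (odd m \<noteq> odd n) + 2 * (m div 2 XOR n div 2)"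
      by (rule xor_rec)
    moreover have "of_bool (odd m \<noteq> odd n) \<le> m mod 2 + n mod 2"
      by (cases "odd m"; cases "odd n") (simp_all add: odd_iff_mod_2_eq_one)
    moreover have "m = 2 * (m div 2) + m mod 2" "n = 2 * (n div 2) + n mod 2"
      by simp_all
    ultimately show ?thesis
      by linarith
  qed simp
qed

text \<open>Interposing \<open>n\<close> twice cancels, which leaves subadditivity of XOR.\<close>

lemma xor_nat_triangle: "m XOR k \<le> (m XOR n) + (n XOR k)" for m n k :: nat
proof -
  have "m XOR k = (m XOR n) XOR (n XOR k)"
    by (rule bit_eqI) (auto simp: bit_simps)
  then show ?thesis
    using xor_nat_le_add by metis
qed

text \<open>Clearing a set digit involves no borrow. In metric terms, \<open>2 ^ i\<close> lies on a
  geodesic from \<open>0\<close> to \<open>n\<close>.\<close>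

lemma xor_exp_add_exp:
  fixes n :: nat
  assumes "bit n i"
  shows "(n XOR 2 ^ i) + 2 ^ i = n"
proof -
  have "(n XOR 2 ^ i) AND 2 ^ i = 0"
    using assms by (intro bit_eqI) (auto simp: bit_simps)
  then have "(n XOR 2 ^ i) + 2 ^ i = (n XOR 2 ^ i) XOR 2 ^ i"
    by (rule disjunctive_add_eq_xor)
  also have "\<dots> = n"
    by (rule bit_eqI) (auto simp: bit_simps)
  finally show ?thesis .
qed

lemma Metric_space_xor: "Metric_space M (\<lambda>m n :: nat. real (m XOR n))"
proof
  fix m n k :: nat
  show "real (m XOR n) = real (n XOR m)"
    by (simp add: xor.commute)
  have "m = n" if "m XOR n = 0"
    using that by (auto simp: bit_eq_iff bit_simps)
  then show "real (m XOR n) = 0 \<longleftrightarrow> m = n"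
    by auto
  show "real (m XOR k) \<le> real (m XOR n) + real (n XOR k)"
    using xor_nat_triangle[of m k n] by linarith
qed simp

lemma locally_finite_xor: "locally_finite_metric_space M (\<lambda>m n. real (m XOR n))"
proof -
  interpret Metric_space M "\<lambda>m n. real (m XOR n)"
    by (rule Metric_space_xor)
  have "mcball m r \<subseteq> {..m + nat \<lfloor>r\<rfloor>}" for m r
  proof
    fix n assume "n \<in> mcball m r"
    then have "m XOR n \<le> nat \<lfloor>r\<rfloor>"
      by (simp add: le_nat_floor)
    \<comment> \<open>Every \<open>n\<close> is its own distance from \<open>0\<close>, so balls are
      bounded sets of natural numbers.\<close>
    moreover have "n \<le> m + (m XOR n)"
      using xor_nat_triangle[of 0 n m] by simp
    ultimately show "n \<in> {..m + nat \<lfloor>r\<rfloor>}"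
      by simp
  qed
  then show ?thesis
    unfolding locally_finite_metric_space_def
    using Metric_space_xor finite_subset by blast
qed

section \<open>Finite XOR cubes inside finite-dimensional l1\<close>

text \<open>Below \<open>2 ^ N\<close> the first \<open>N\<close> digits suffice, and digit
  \<open>i\<close> contributes \<open>2 ^ i\<close> exactly where \<open>m\<close> and
  \<open>n\<close> differ. This makes XOR an l1 distance between weighted digit vectors.\<close>

lemma xor_eq_sum_bits:
  fixes m n :: nat
  assumes "m < 2 ^ N" "n < 2 ^ N"
  shows "real (m XOR n) = (\<Sum>i<N. \<bar>2 ^ i * of_bool (bit m i) - 2 ^ i * of_bool (bit n i)\<bar>)"
proof -
  have "take_bit N (m XOR n) = m XOR n"
    using assms by (simp add: take_bit_xor take_bit_nat_eq_self)
  then have "m XOR n = (\<Sum>i<N. push_bit i (of_bool (bit (m XOR n) i)))"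
    by (metis take_bit_sum lessThan_atLeast0)
  then have "real (m XOR n) = (\<Sum>i<N. real (push_bit i (of_bool (bit (m XOR n) i))))"
    by (metis of_nat_sum)
  also have "\<dots> = (\<Sum>i<N. \<bar>2 ^ i * of_bool (bit m i) - 2 ^ i * of_bool (bit n i)\<bar>)"
    by (intro sum.cong) (auto simp: push_bit_eq_mult bit_xor_iff)
  finally show ?thesis .
qed

lemma contains_xor_cube:
  assumes "contains_l1_isometrically (UNIV :: 'a::real_normed_vector set) {..<N}"
  shows "contains_metric_isometrically (UNIV :: 'a set) {..<2 ^ N} (\<lambda>m n. real (m XOR n))"
proof -
  obtain T :: "(nat \<Rightarrow> real) \<Rightarrow> 'a" where "l1_linear_isometry {..<N} T"
    using assms by (auto simp: contains_l1_isometrically_def)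
  then have T: "\<forall>x\<in>l1_space {..<N}. \<forall>y\<in>l1_space {..<N}. T (\<lambda>i. x i + y i) = T x + T y"
      "\<forall>c. \<forall>x\<in>l1_space {..<N}. T (\<lambda>i. c * x i) = c *\<^sub>R T x"
      "\<forall>x\<in>l1_space {..<N}. norm (T x) = l1_norm {..<N} x"
    unfolding l1_linear_isometry_def by blast+
  define e where "e m i = (if i < N then 2 ^ i * of_bool (bit m i) else 0 :: real)" for m :: nat and i
  \<comment> \<open>Differences are written with \<open>- 1 *\<close>, the form to which additivity
    and homogeneity of \<open>T\<close> apply.\<close>
  have e: "e m \<in> l1_space {..<N}" and e': "(\<lambda>i. - 1 * e m i) \<in> l1_space {..<N}" for m
    by (auto simp: l1_space_def e_def)
  have diff: "(\<lambda>i. e m i + - 1 * e n i) \<in> l1_space {..<N}" for m n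
    by (auto simp: l1_space_def e_def)
  have "dist (T (e m)) (T (e n)) = real (m XOR n)" if "m < 2 ^ N" "n < 2 ^ N" for m n
  proof -
    have "T (\<lambda>i. e m i + - 1 * e n i) = T (e m) - T (e n)"
      using T(1)[rule_format, OF e[of m] e'[of n]] T(2)[rule_format, OF e[of n], of "- 1"] by simp
    then have "dist (T (e m)) (T (e n)) = (\<Sum>i<N. \<bar>e m i + - 1 * e n i\<bar>)"
      using T(3)[rule_format, OF diff[of m n]] by (simp add: dist_norm l1_norm_def)
    also have "\<dots> = real (m XOR n)"
      unfolding xor_eq_sum_bits[OF that] by (intro sum.cong) (auto simp: e_def)
    finally show ?thesis .
  qed
  then show ?thesis
    unfolding contains_metric_isometrically_def by (intro exI[of _ "\<lambda>m. T (e m)"]) auto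
qed

section \<open>Lower l1 estimates from geodesics\<close>

text \<open>
  The hypothesis says that a functional norming \<open>V\<close> norms every \<open>v i\<close>; stating it through norms
  avoids the Hahn--Banach theorem.
\<close>

lemma norm_sum_segments_ge:
  fixes v :: "'i \<Rightarrow> 'a::real_normed_vector"
  assumes seg: "\<And>i. i \<in> I \<Longrightarrow> norm (V - v i) + norm (v i) \<le> norm V"
    and c: "\<And>i. i \<in> I \<Longrightarrow> 0 \<le> c i"
  shows "(\<Sum>i\<in>I. c i * norm (v i)) \<le> norm (\<Sum>i\<in>I. c i *\<^sub>R v i)"
proof -
  \<comment> \<open>Nonnegative multiples of one vector add up without loss of norm; each copy of
    \<open>V\<close> is then split into \<open>v i\<close> and \<open>V - v i\<close>.\<close>
  have "(\<Sum>i\<in>I. c i * norm V) = norm (\<Sum>i\<in>I. c i *\<^sub>R V)"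
    using c by (simp add: scaleR_left.sum [symmetric] sum_distrib_right [symmetric] sum_nonneg)
  also have "(\<Sum>i\<in>I. c i *\<^sub>R V) = (\<Sum>i\<in>I. c i *\<^sub>R v i) + (\<Sum>i\<in>I. c i *\<^sub>R (V - v i))"
    by (simp add: sum.distrib [symmetric] scaleR_add_right [symmetric])
  also have "norm \<dots> \<le> norm (\<Sum>i\<in>I. c i *\<^sub>R v i) + (\<Sum>i\<in>I. norm (c i *\<^sub>R (V - v i)))"
    by (intro norm_triangle_le add_left_mono norm_sum)
  also have "(\<Sum>i\<in>I. norm (c i *\<^sub>R (V - v i))) \<le> (\<Sum>i\<in>I. c i * (norm V - norm (v i)))"
  proof (rule sum_mono)
    fix i assume "i \<in> I"
    then show "norm (c i *\<^sub>R (V - v i)) \<le> c i * (norm V - norm (v i))"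
      using seg[of i] c[of i] by (simp add: mult_left_mono)
  qed
  finally show ?thesis
    by (simp add: right_diff_distrib sum_subtractf)
qed

lemma xor_isometry_norm_sum_ge:
  fixes f :: "nat \<Rightarrow> 'a::real_normed_vector"
  assumes f: "\<And>m n. norm (f m - f n) = real (m XOR n)"
  shows "(\<Sum>i<n. \<bar>a i\<bar> * 2 ^ i) \<le> norm (\<Sum>i<n. a i *\<^sub>R (f (2 ^ i) - f 0))"
proof -
  \<comment> \<open>\<open>p\<close> codes the indices with nonnegative coefficient, zero included,
    and \<open>q\<close> the remaining ones below \<open>n\<close>.\<close>
  define p :: nat where "p = horner_sum of_bool 2 (map (\<lambda>i. 0 \<le> a i) [0..<n])"
  define q where "q = p XOR mask n"
  have p: "bit p i \<longleftrightarrow> i < n \<and> 0 \<le> a i" for i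
    by (auto simp: p_def bit_horner_sum_bit_iff)
  have q: "bit q i \<longleftrightarrow> i < n \<and> a i < 0" for i
    by (auto simp: q_def p bit_simps)
  \<comment> \<open>Disjointness puts \<open>0\<close> on a geodesic from \<open>q\<close> to
    \<open>p\<close>.\<close>
  have "p AND q = 0"
    by (rule bit_eqI) (auto simp: p q bit_simps)
  then have pq: "p XOR q = p + q"
    by (simp add: disjunctive_add_eq_xor)
  define v where "v i = (if 0 \<le> a i then f (2 ^ i) - f 0 else f 0 - f (2 ^ i))" for i
  have norm_v: "norm (v i) = 2 ^ i" for i
    by (simp add: v_def f)
  have "norm (f p - f q - v i) + norm (v i) \<le> norm (f p - f q)" if "i < n" for i
  proof (cases "0 \<le> a i")
    case True
    \<comment> \<open>The geodesic runs from \<open>q\<close> through \<open>0\<close> and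
      \<open>2 ^ i\<close> to \<open>p\<close>; removing its middle segment leaves the two outer
      ones.\<close>
    have "f p - f q - v i = (f p - f (2 ^ i)) + (f 0 - f q)"
      using True by (simp add: v_def)
    then have "norm (f p - f q - v i) \<le> real (p XOR 2 ^ i) + real q"
      using norm_triangle_ineq[of "f p - f (2 ^ i)" "f 0 - f q"]
      by (simp only: f) simp
    moreover have "real (p XOR 2 ^ i) + 2 ^ i = real p"
      using xor_exp_add_exp[of p i] p that True
      by (metis of_nat_add of_nat_power of_nat_numeral)
    ultimately show ?thesis
      by (simp add: norm_v f pq)
  next
    case False
    \<comment> \<open>Here \<open>2 ^ i\<close> is part of \<open>q\<close>, so the geodesic passes
      \<open>2 ^ i\<close> before \<open>0\<close>.\<close>
    have "f p - f q - v i = (f p - f 0) + (f (2 ^ i) - f q)"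
      using False by (simp add: v_def)
    then have "norm (f p - f q - v i) \<le> real p + real (q XOR 2 ^ i)"
      using norm_triangle_ineq[of "f p - f 0" "f (2 ^ i) - f q"]
      by (simp only: f) (simp add: xor.commute)
    moreover have "real (q XOR 2 ^ i) + 2 ^ i = real q"
      using xor_exp_add_exp[of q i] q that False
      by (metis of_nat_add of_nat_power of_nat_numeral not_le)
    ultimately show ?thesis
      by (simp add: norm_v f pq)
  qed
  then have "(\<Sum>i<n. \<bar>a i\<bar> * norm (v i)) \<le> norm (\<Sum>i<n. \<bar>a i\<bar> *\<^sub>R v i)"
    by (intro norm_sum_segments_ge) auto
  moreover have "\<bar>a i\<bar> *\<^sub>R v i = a i *\<^sub>R (f (2 ^ i) - f 0)" for i
    by (simp add: v_def scaleR_diff_right)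
  ultimately show ?thesis
    by (simp add: norm_v)
qed

section \<open>Linear copies of l1 from norm estimates\<close>

text \<open>The two bounds force equality of norms on finite combinations. Completeness makes the
  series for \<open>T\<close> converge, and the equality passes to the limit of partial
  sums.\<close>

lemma contains_l1_UNIV_I:
  fixes u :: "nat \<Rightarrow> 'a::banach"
  assumes u: "\<And>i. norm (u i) \<le> 1"
    and ge: "\<And>n a. (\<Sum>i<n. \<bar>a i\<bar>) \<le> norm (\<Sum>i<n. a i *\<^sub>R u i)"
  shows "contains_l1_isometrically (UNIV :: 'a set) UNIV"
proof -
  define T where "T x = (\<Sum>i. x i *\<^sub>R u i)" for x :: "nat \<Rightarrow> real"
  have l1: "x \<in> l1_space UNIV \<longleftrightarrow> summable (\<lambda>i. \<bar>x i\<bar>)" for x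
    by (simp add: l1_space_def summable_on_UNIV_nonneg_real_iff)
  have le: "norm (x i *\<^sub>R u i) \<le> \<bar>x i\<bar>" for x :: "nat \<Rightarrow> real" and i
    using u[of i] by (simp add: mult_left_le)
  have summable: "summable (\<lambda>i. x i *\<^sub>R u i)" if "x \<in> l1_space UNIV" for x
    using that by (auto intro: summable_comparison_test' le simp: l1)
  have add: "T (\<lambda>i. x i + y i) = T x + T y" if "x \<in> l1_space UNIV" "y \<in> l1_space UNIV" for x y
    using that by (simp add: T_def scaleR_add_left suminf_add summable)
  have scale: "T (\<lambda>i. c * x i) = c *\<^sub>R T x" if "x \<in> l1_space UNIV" for c x
    using suminf_scaleR_right[OF summable[OF that], of c] by (simp add: T_def)
  have norm: "norm (T x) = l1_norm UNIV x" if x: "x \<in> l1_space UNIV" for x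
  proof -
    have "(\<lambda>n. norm (\<Sum>i<n. x i *\<^sub>R u i)) \<longlonglongrightarrow> norm (T x)"
      unfolding T_def by (intro tendsto_norm summable_LIMSEQ summable x)
    moreover have "norm (\<Sum>i<n. x i *\<^sub>R u i) = (\<Sum>i<n. \<bar>x i\<bar>)" for n
      using ge[of x n] sum_norm_le[of "{..<n}" "\<lambda>i. x i *\<^sub>R u i" "\<lambda>i. \<bar>x i\<bar>"] le
      by (simp add: order_antisym)
    ultimately have "(\<lambda>i. \<bar>x i\<bar>) sums norm (T x)"
      by (simp add: sums_def)
    then have "((\<lambda>i. \<bar>x i\<bar>) has_sum norm (T x)) UNIV"
      by (intro norm_summable_imp_has_sum) (simp_all add: sums_iff)
    then show ?thesis
      by (simp add: l1_norm_def infsumI)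
  qed
  have "subspace (T ` l1_space UNIV)"
    unfolding subspace_def
  proof (intro conjI ballI allI)
    have "T (\<lambda>i. 0) = 0" "(\<lambda>i. 0) \<in> l1_space UNIV"
      by (simp_all add: T_def l1)
    then show "0 \<in> T ` l1_space UNIV"
      by (metis image_eqI)
  next
    fix a b assume "a \<in> T ` l1_space UNIV" "b \<in> T ` l1_space UNIV"
    then obtain x y where "a = T x" "x \<in> l1_space UNIV" "b = T y" "y \<in> l1_space UNIV"
      by blast
    moreover from this have "(\<lambda>i. x i + y i) \<in> l1_space UNIV"
      unfolding l1
      by (intro summable_comparison_test[of "\<lambda>i. \<bar>x i + y i\<bar>" "\<lambda>i. \<bar>x i\<bar> + \<bar>y i\<bar>"] summable_add) auto
    ultimately show "a + b \<in> T ` l1_space UNIV"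
      by (intro image_eqI[of _ _ "\<lambda>i. x i + y i"]) (simp_all add: add)
  next
    fix c a assume "a \<in> T ` l1_space UNIV"
    then obtain x where "a = T x" "x \<in> l1_space UNIV"
      by blast
    moreover from this have "(\<lambda>i. c * x i) \<in> l1_space UNIV"
      by (simp add: l1 abs_mult summable_mult)
    ultimately show "c *\<^sub>R a \<in> T ` l1_space UNIV"
      by (intro image_eqI[of _ _ "\<lambda>i. c * x i"]) (simp_all add: scale)
  qed
  moreover have "l1_linear_isometry UNIV T"
    using add scale norm by (auto simp: l1_linear_isometry_def)
  ultimately show ?thesis
    by (auto simp: contains_l1_isometrically_def)
qed

theorem corollary6p4:
  assumes "\<And>n::nat. contains_l1_isometrically (UNIV :: 'a::banach set) {..<n}"
    and "\<not> contains_l1_isometrically (UNIV :: 'a set) UNIV"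
  shows "\<exists>(M :: nat set) (d :: nat \<Rightarrow> nat \<Rightarrow> real).
           locally_finite_metric_space M d \<and>
           (\<forall>F. F \<subseteq> M \<and> finite F \<longrightarrow> contains_metric_isometrically (UNIV :: 'a set) F d) \<and>
           \<not> contains_metric_isometrically (UNIV :: 'a set) M d"
proof (intro exI conjI allI impI)
  let ?d = "\<lambda>m n :: nat. real (m XOR n)"
  show "locally_finite_metric_space UNIV ?d"
    by (rule locally_finite_xor)
  show "contains_metric_isometrically (UNIV :: 'a set) F ?d" if F: "F \<subseteq> UNIV \<and> finite F" for F
  proof -
    obtain N where "F \<subseteq> {..<N}"
      using F finite_nat_iff_bounded[of F] by blast
    then have "F \<subseteq> {..<2 ^ N}"
      using less_exp[of N] by (meson lessThan_subset_iff less_imp_le_nat subset_trans)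
    then show ?thesis
      using contains_xor_cube[OF assms(1)[of N]]
      unfolding contains_metric_isometrically_def by blast
  qed
  show "\<not> contains_metric_isometrically (UNIV :: 'a set) UNIV ?d"
  proof
    assume "contains_metric_isometrically (UNIV :: 'a set) UNIV ?d"
    then obtain f :: "nat \<Rightarrow> 'a" where f: "norm (f m - f n) = real (m XOR n)" for m n
      by (auto simp: contains_metric_isometrically_def dist_norm)
    define u where "u i = (1 / 2 ^ i) *\<^sub>R (f (2 ^ i) - f 0)" for i
    have "norm (u i) \<le> 1" for i
      unfolding u_def norm_scaleR f by simp
    moreover have "(\<Sum>i<n. \<bar>a i\<bar>) \<le> norm (\<Sum>i<n. a i *\<^sub>R u i)" for n a
      \<comment> \<open>Dividing the coefficients by \<open>2 ^ i\<close> cancels the weights and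
        normalises the differences to \<open>u i\<close>.\<close>
      using xor_isometry_norm_sum_ge[OF f, where n = n and a = "\<lambda>i. a i / 2 ^ i"]
      by (simp add: u_def)
    ultimately show False
      using contains_l1_UNIV_I assms(2) by blast
  qed
qed

end
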